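(* Let $I\subset[X]$ be a monoid ideal with minimal generating set $W(I)$. For finite $\sigma\subset W(I)$ let $\mathrm{lcm}(\sigma)$ be the least common multiple of the elements of $\sigma$ and $\#\sigma$ its cardinality. Then $$p(I)=\sum_{\sigma}(-1)^{\#\sigma}\,\mathrm{lcm}(\sigma),$$ where the sum is over all finite subsets $\sigma$ of $W(I)$. Alternatively, $$p(I)=1-\sum_{m\in W(I)}m+\sum_{\sigma\in\binom{W(I)}{2}}\mathrm{lcm}(\sigma)-\sum_{\sigma\in\binom{W(I)}{3}}\mathrm{lcm}(\sigma)+\cdots.$$
   Context: $X=\{x_1,x_2,\dots\}$; $[X]$ is the free abelian monoid of monomials in $X$. A monoid ideal is a subset $I\subset[X]$ with $[X]I\subset I$; $W(I)=I\setminus([X]\setminus\{1\})I$ is its canonical set of minimal generators. $\mathbb{Z}[[X]]$ is the ring of all formal sums $\sum_{m\in[X]}c_m m$, $c_m\in\mathbb{Z}$, with convolution product and the product topology, in which infinite sums are interpreted (coefficientwise: an infinite sum converges if each monomial occurs in the support of only finitely many terms). $p(I)=\mu\cdot\sum_{m\in[X]\setminus I}m$, where $\mu=\prod_{i\ge1}(1-x_i)$. $\binom{A}{k}$ is the set of $k$-element subsets of $A$, and $\mathrm{lcm}(\emptyset)=1$. *)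

theory Defs
  imports "HOL-Analysis.Analysis" "HOL-Library.Ramsey"
begin

text \<open>
  The free abelian monoid on countably many variables is \<open>nat multiset\<close>, written additively:
  \<open>a + b\<close> is the product of two monomials, \<open>{#}\<close> is the monomial 1, divisibility is
  \<open>\<subseteq>#\<close>, and index \<open>i\<close> stands for the variable usually called \<open>x\<^sub>i\<^sub>+\<^sub>1\<close>.
\<close>

type_synonym monomial = "nat multiset"

text \<open>
  The next two definitions use the elementwise sum of sets from \<^theory>\<open>HOL-Library.Set_Algebras\<close>,
  so that \<open>A + I\<close> is the set of products of a monomial in \<open>A\<close> and a monomial in \<open>I\<close>.
\<close>

definition monoid_ideal :: "monomial set \<Rightarrow> bool" where
  "monoid_ideal I \<longleftrightarrow> UNIV + I \<subseteq> I"

definition min_gens :: "monomial set \<Rightarrow> monomial set" where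
  "min_gens I = I - ((UNIV - {{#}}) + I)"

text \<open>
  \<open>Sup\<close> on multisets is the supremum with respect to \<open>\<subseteq>#\<close>; for a finite set of monomials this is
  the least common multiple (see the lemmas below), and it is \<open>{#}\<close> for the empty set.
\<close>

definition lcm_mon :: "monomial set \<Rightarrow> monomial" where
  "lcm_mon \<sigma> = Sup \<sigma>"

lemma bdd_above_finite_mset:
  fixes \<sigma> :: "monomial set"
  assumes "finite \<sigma>"
  shows "subset_mset.bdd_above \<sigma>"
proof (rule subset_mset.bdd_aboveI)
  fix a assume "a \<in> \<sigma>"
  then show "a \<subseteq># sum (\<lambda>x. x) \<sigma>"
    by (simp add: assms sum.remove)
qed

lemma lcm_mon_empty: "lcm_mon {} = {#}"
  by (simp add: lcm_mon_def Sup_multiset_empty)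

lemma dvd_lcm_mon: "finite \<sigma> \<Longrightarrow> m \<in> \<sigma> \<Longrightarrow> m \<subseteq># lcm_mon \<sigma>"
  unfolding lcm_mon_def by (intro subset_mset.cSup_upper bdd_above_finite_mset)

lemma lcm_mon_least: "finite \<sigma> \<Longrightarrow> (\<And>m. m \<in> \<sigma> \<Longrightarrow> m \<subseteq># u) \<Longrightarrow> lcm_mon \<sigma> \<subseteq># u"
  by (cases "\<sigma> = {}")
     (auto simp: Sup_multiset_empty lcm_mon_def intro: subset_mset.cSup_least)

text \<open>The ring \<open>\<int>[[X]]\<close> of all formal sums of monomials.\<close>

typedef mseries = "UNIV :: (monomial \<Rightarrow> int) set"
  morphisms mcoeff Abs_mseries ..

setup_lifting type_definition_mseries

lemma mseries_eqI: "(\<And>m. mcoeff f m = mcoeff g m) \<Longrightarrow> f = g"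
  by (simp add: mcoeff_inject[symmetric] fun_eq_iff)

lemma finite_divisors: "finite {a. a \<subseteq># (m :: monomial)}"
proof (induction m)
  case (add x m)
  have "{a. a \<subseteq># add_mset x m} \<subseteq> {a. a \<subseteq># m} \<union> add_mset x ` {a. a \<subseteq># m}"
  proof
    fix a assume "a \<in> {a. a \<subseteq># add_mset x m}"
    then have a: "a \<subseteq># add_mset x m" by simp
    show "a \<in> {a. a \<subseteq># m} \<union> add_mset x ` {a. a \<subseteq># m}"
    proof (cases "x \<in># a")
      case True
      then obtain b where "a = add_mset x b" by (meson multi_member_split)
      with a show ?thesis by simp
    next
      case False
      have "a \<subseteq># m"
      proof (rule mset_subset_eqI)
        fix y
        show "count a y \<le> count m y"
          using False mset_subset_eq_count[OF a, of y]
          by (cases "y = x") (auto simp: not_in_iff)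
      qed
      then show ?thesis by simp
    qed
  qed
  then show ?case
    by (rule finite_subset) (use add in simp)
qed simp

lemma finite_factorizations: "finite {(a, b). a + b = (m :: monomial)}"
proof (rule finite_subset)
  show "{(a, b). a + b = m} \<subseteq> {a. a \<subseteq># m} \<times> {a. a \<subseteq># m}" by auto
  show "finite ({a. a \<subseteq># m} \<times> {a. a \<subseteq># m})"
    by (simp add: finite_divisors)
qed

instantiation mseries :: comm_ring_1
begin

lift_definition zero_mseries :: mseries is "\<lambda>_. 0" .
lift_definition one_mseries :: mseries is "\<lambda>m. if m = {#} then 1 else 0" .
lift_definition plus_mseries :: "mseries \<Rightarrow> mseries \<Rightarrow> mseries" is "\<lambda>f g m. f m + g m" .
lift_definition minus_mseries :: "mseries \<Rightarrow> mseries \<Rightarrow> mseries" is "\<lambda>f g m. f m - g m" .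
lift_definition uminus_mseries :: "mseries \<Rightarrow> mseries" is "\<lambda>f m. - f m" .
lift_definition times_mseries :: "mseries \<Rightarrow> mseries \<Rightarrow> mseries"
  is "\<lambda>f g m. \<Sum>(a, b) | a + b = m. f a * g b" .

instance
proof
  fix f g h :: mseries
  show "f + g + h = f + (g + h)" by transfer (simp add: fun_eq_iff)
  show "f + g = g + f" by transfer (simp add: fun_eq_iff)
  show "0 + f = f" by transfer simp
  show "- f + f = 0" by transfer simp
  show "f - g = f + - g" by transfer simp
  show "(0::mseries) \<noteq> 1" by transfer (auto simp: fun_eq_iff)
  show "f * g = g * f"
  proof (transfer, rule ext)
    fix f g :: "monomial \<Rightarrow> int" and m
    show "(\<Sum>(a, b) | a + b = m. f a * g b) = (\<Sum>(a, b) | a + b = m. g a * f b)"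
      by (rule sum.reindex_bij_witness[of _ prod.swap prod.swap]) (auto simp: ac_simps)
  qed
  show "1 * f = f"
  proof (transfer, rule ext)
    fix f :: "monomial \<Rightarrow> int" and m
    have "(\<Sum>(a, b) | a + b = m. (if a = {#} then 1 else 0) * f b)
        = (\<Sum>(a, b)\<in>{({#} :: monomial, m)}. (if a = {#} then 1 else 0) * f b)"
      by (rule sum.mono_neutral_right) (use finite_factorizations in \<open>auto split: if_splits\<close>)
    then show "(\<Sum>(a, b) | a + b = m. (if a = {#} then 1 else 0) * f b) = f m" by simp
  qed
  show "(f + g) * h = f * h + g * h"
    by transfer (simp add: fun_eq_iff distrib_right sum.distrib case_prod_unfold)
  show "f * g * h = f * (g * h)"
  proof (transfer, rule ext)
    fix f g h :: "monomial \<Rightarrow> int" and m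
    have "(\<Sum>(u, c) | u + c = m. (\<Sum>(a, b) | a + b = u. f a * g b) * h c)
        = (\<Sum>p\<in>{(u, c). u + c = m}. \<Sum>q\<in>{(a, b). a + b = fst p}. f (fst q) * g (snd q) * h (snd p))"
      by (simp add: case_prod_unfold sum_distrib_right)
    also have "\<dots> = (\<Sum>(p, q)\<in>Sigma {(u, c). u + c = m} (\<lambda>p. {(a, b). a + b = fst p}).
        f (fst q) * g (snd q) * h (snd p))"
      by (rule sum.Sigma) (use finite_factorizations in auto)
    also have "\<dots> = (\<Sum>(p, q)\<in>Sigma {(a, v). a + v = m} (\<lambda>p. {(b, c). b + c = snd p}).
        f (fst p) * (g (fst q) * h (snd q)))"
      by (rule sum.reindex_bij_witness[of _
            "\<lambda>((a, v), (b, c)). ((a + b, c), (a, b))" "\<lambda>((u, c), (a, b)). ((a, b + c), (b, c))"])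
         (auto simp: ac_simps)
    also have "\<dots> = (\<Sum>p\<in>{(a, v). a + v = m}. \<Sum>q\<in>{(b, c). b + c = snd p}.
        f (fst p) * (g (fst q) * h (snd q)))"
      by (rule sum.Sigma[symmetric]) (use finite_factorizations in auto)
    also have "\<dots> = (\<Sum>(a, v) | a + v = m. f a * (\<Sum>(b, c) | b + c = v. g b * h c))"
      by (simp add: case_prod_unfold sum_distrib_left)
    finally show "(\<Sum>(u, c) | u + c = m. (\<Sum>(a, b) | a + b = u. f a * g b) * h c)
        = (\<Sum>(a, v) | a + v = m. f a * (\<Sum>(b, c) | b + c = v. g b * h c))" .
  qed
qed

end

instantiation mseries :: t2_space
begin

text \<open>The product topology: \<open>\<int>\<close> is discrete and functions carry the topology of pointwise convergence.\<close>

definition open_mseries :: "mseries set \<Rightarrow> bool" where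
  "open_mseries U \<longleftrightarrow> open (mcoeff ` U)"

lemma open_mseries_vimage: "open V \<Longrightarrow> open (mcoeff -` V)"
  unfolding open_mseries_def
  by (metis UNIV_I Abs_mseries_inverse image_vimage_eq inf_top.right_neutral surjI)

instance
proof
  have inj: "inj mcoeff" by (rule injI) (simp add: mcoeff_inject)
  have range: "range mcoeff = UNIV" by (rule type_definition.Rep_range[OF type_definition_mseries])
  show "open (UNIV :: mseries set)" by (simp add: open_mseries_def range)
  show "open (S \<inter> T)" if "open S" "open T" for S T :: "mseries set"
    using that by (simp add: open_mseries_def image_Int[OF inj] open_Int)
  show "open (\<Union>K)" if "\<forall>S\<in>K. open S" for K :: "mseries set set"
    using that unfolding open_mseries_def image_Union by (intro open_UN) auto
  show "\<exists>U V. open U \<and> open V \<and> f \<in> U \<and> g \<in> V \<and> U \<inter> V = {}" if "f \<noteq> g" for f g :: mseries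
  proof -
    from that have "mcoeff f \<noteq> mcoeff g" by (simp add: mcoeff_inject)
    then obtain m where m: "mcoeff f m \<noteq> mcoeff g m" by (auto simp: fun_eq_iff)
    define C where "C c = mcoeff -` ((\<lambda>h. h m) -` {c})" for c :: int
    have "open ((\<lambda>h :: monomial \<Rightarrow> int. h m) -` {c})" for c
      by (rule open_vimage[OF open_discrete continuous_on_product_coordinates])
    then have "open (C c)" for c
      unfolding C_def by (rule open_mseries_vimage)
    moreover have "f \<in> C (mcoeff f m)" "g \<in> C (mcoeff g m)" "C (mcoeff f m) \<inter> C (mcoeff g m) = {}"
      using m by (auto simp: C_def)
    ultimately show ?thesis
      by (intro exI[of _ "C (mcoeff f m)"] exI[of _ "C (mcoeff g m)"] conjI)
  qed
qed

end

lemma tendsto_mseries_iff: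
  "(f \<longlongrightarrow> l) F \<longleftrightarrow> (\<forall>m. eventually (\<lambda>x. mcoeff (f x) m = mcoeff l m) F)"
proof -
  have "(f \<longlongrightarrow> l) F \<longleftrightarrow> ((\<lambda>x. mcoeff (f x)) \<longlongrightarrow> mcoeff l) F"
  proof
    assume *: "(f \<longlongrightarrow> l) F"
    show "((\<lambda>x. mcoeff (f x)) \<longlongrightarrow> mcoeff l) F"
    proof (rule topological_tendstoI)
      fix V assume "open V" "mcoeff l \<in> V"
      then show "eventually (\<lambda>x. mcoeff (f x) \<in> V) F"
        using topological_tendstoD[OF * open_mseries_vimage, of V] by simp
    qed
  next
    assume *: "((\<lambda>x. mcoeff (f x)) \<longlongrightarrow> mcoeff l) F"
    show "(f \<longlongrightarrow> l) F"
    proof (rule topological_tendstoI)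
      fix U assume "open U" "l \<in> U"
      then have "eventually (\<lambda>x. mcoeff (f x) \<in> mcoeff ` U) F"
        by (intro topological_tendstoD[OF *]) (auto simp: open_mseries_def)
      then show "eventually (\<lambda>x. f x \<in> U) F"
        by eventually_elim (auto simp: mcoeff_inject)
    qed
  qed
  also have "\<dots> \<longleftrightarrow> (\<forall>m. ((\<lambda>x. mcoeff (f x) m) \<longlongrightarrow> mcoeff l m) F)"
    using limitin_componentwise[of "\<lambda>_. euclidean" UNIV "\<lambda>x. mcoeff (f x)" "mcoeff l" F]
    by (simp add: euclidean_product_topology flip: limitin_canonical_iff)
  also have "\<dots> \<longleftrightarrow> (\<forall>m. eventually (\<lambda>x. mcoeff (f x) m = mcoeff l m) F)"
    by (simp add: tendsto_discrete)
  finally show ?thesis .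
qed

lift_definition of_mon :: "monomial \<Rightarrow> mseries" is "\<lambda>m n. if n = m then 1 else 0" .

lemma of_mon_one: "of_mon {#} = 1"
  by transfer simp

lemma mcoeff_sum: "mcoeff (sum f A) m = (\<Sum>a\<in>A. mcoeff (f a) m)"
  by (induction A rule: infinite_finite_induct)
     (simp_all add: zero_mseries.rep_eq plus_mseries.rep_eq)

lemma of_mon_mult: "of_mon (a + b) = of_mon a * of_mon b"
proof (transfer, rule ext)
  fix a b n :: monomial
  have "(\<Sum>(c, d) | c + d = n. (if c = a then 1 else 0) * (if d = b then 1 else 0 :: int))
      = (\<Sum>(c, d)\<in>(if n = a + b then {(a, b)} else {}).
          (if c = a then 1 else 0) * (if d = b then 1 else 0))"
    by (rule sum.mono_neutral_right) (use finite_factorizations in \<open>auto split: if_splits\<close>)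
  then show "(if n = a + b then 1 else 0) =
      (\<Sum>(c, d) | c + d = n. (if c = a then 1 else 0) * (if d = b then 1 else 0 :: int))"
    by simp
qed

text \<open>
  Infinite sums are taken with \<^const>\<open>HAS_SUM\<close> and \<^const>\<open>infsum\<close> in the product topology.
  The sum of any set of monomials converges, and so does the product defining \<open>mu\<close>.
\<close>

lemma has_sum_of_mon: "(of_mon has_sum Abs_mseries (\<lambda>m. if m \<in> A then 1 else 0)) A"
  unfolding has_sum_def tendsto_mseries_iff
proof
  fix m :: monomial
  have "eventually (\<lambda>F. finite F \<and> A \<inter> {m} \<subseteq> F \<and> F \<subseteq> A) (finite_subsets_at_top A)"
    unfolding eventually_finite_subsets_at_top by (rule exI[of _ "A \<inter> {m}"]) auto
  then show "eventually (\<lambda>F. mcoeff (sum of_mon F) m =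
      mcoeff (Abs_mseries (\<lambda>m. if m \<in> A then 1 else 0)) m) (finite_subsets_at_top A)"
    by eventually_elim (auto simp: mcoeff_sum of_mon.rep_eq Abs_mseries_inverse)
qed

definition mu :: mseries where
  "mu = (\<Prod>i. 1 - of_mon {#i#})"

lemma has_prod_mu: "(\<lambda>i. 1 - of_mon {#i#}) has_prod mu"
proof -
  define P where "P n = (\<Prod>i\<le>n. 1 - of_mon {#i#})" for n :: nat
  have vanish: "mcoeff (f * of_mon {#i#}) m = 0" if "i \<notin># m" for f i m
    unfolding times_mseries.rep_eq of_mon.rep_eq
    by (rule sum.neutral) (use that in auto)
  have step: "mcoeff (P (Suc n)) m = mcoeff (P n) m" if "Suc n \<notin># m" for n m
    using vanish[OF that, of "P n"] by (simp add: P_def algebra_simps minus_mseries.rep_eq)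
  define N where "N m = Max (insert 0 (set_mset m))" for m :: monomial
  have stable: "mcoeff (P (N m + k)) m = mcoeff (P (N m)) m" for m k
  proof (induction k)
    case (Suc k)
    have "Suc (N m + k) \<notin># m"
    proof
      assume "Suc (N m + k) \<in># m"
      then have "Suc (N m + k) \<le> N m" unfolding N_def by (intro Max_ge) auto
      then show False by simp
    qed
    then show ?case using Suc step by simp
  qed simp
  define L where "L = Abs_mseries (\<lambda>m. mcoeff (P (N m)) m)"
  have lim: "P \<longlonglongrightarrow> L"
    unfolding tendsto_mseries_iff
  proof
    fix m
    show "eventually (\<lambda>n. mcoeff (P n) m = mcoeff L m) sequentially"
      using eventually_ge_at_top[of "N m"]
      by eventually_elim (auto simp: L_def Abs_mseries_inverse stable dest!: le_Suc_ex)
  qed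
  have "mcoeff (P 0) {#} = 1"
    by (simp add: P_def minus_mseries.rep_eq one_mseries.rep_eq of_mon.rep_eq)
  then have "mcoeff L {#} = 1"
    by (simp add: L_def Abs_mseries_inverse N_def)
  then have "L \<noteq> 0"
    by (auto simp: zero_mseries.rep_eq)
  with lim have "(\<lambda>i. 1 - of_mon {#i#}) has_prod L"
    by (simp add: has_prod_def raw_has_prod_def P_def[abs_def])
  moreover have "q = L" if "(\<lambda>i. 1 - of_mon {#i#}) has_prod q" for q
  proof -
    have "mcoeff (1 - of_mon {#i#}) {#} = 1" for i
      by (simp add: minus_mseries.rep_eq one_mseries.rep_eq of_mon.rep_eq)
    then have "1 - of_mon {#i#} \<noteq> 0" for i
      by (metis zero_mseries.rep_eq zero_neq_one)
    with that have "P \<longlonglongrightarrow> q"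
      by (auto simp: has_prod_def raw_has_prod_def P_def[abs_def])
    with lim show ?thesis
      using LIMSEQ_unique by blast
  qed
  ultimately show ?thesis
    unfolding mu_def prodinf_def by (rule theI)
qed

definition p_series :: "monomial set \<Rightarrow> mseries" where
  "p_series I = mu * (\<Sum>\<^sub>\<infinity>m\<in>UNIV - I. of_mon m)"

end

theory Submission
  imports Defs
begin

text \<open>
  Let \<open>H\<close> be the sum of all monomials and \<open>S\<close> the signed sum of the least common multiples of the
  finite sets of minimal generators. Multiplying \<open>H\<close> by the factors \<open>1 - x\<^sub>i\<close> of \<open>\<mu>\<close> one after the other
  removes the monomials that contain \<open>x\<^sub>i\<close>; in the limit only 1 is left, that is, \<open>\<mu> * H = 1\<close>
  (\<open>mu_mult_all_monomials\<close>). Multiplication by \<open>H\<close> sums coefficients over divisors, and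
  \<open>lcm \<sigma>\<close> divides \<open>m\<close> exactly when every element of \<open>\<sigma>\<close> does. Hence the coefficient of \<open>S * H\<close> at
  \<open>m\<close> is \<open>\<Sum>\<sigma>\<in>Pow D. (-1) ^ card \<sigma>\<close>, where \<open>D\<close> is the set of minimal generators dividing \<open>m\<close>. This
  \<open>D\<close> is finite since \<open>m\<close> has finitely many divisors, so the alternating sum is 1 if \<open>D\<close> is empty and 0
  otherwise. As \<open>I\<close> consists of the multiples of its minimal generators, \<open>S * H\<close> is the sum of
  the monomials outside \<open>I\<close>
  (\<open>signed_lcm_sum_mult_all_monomials\<close>, \<open>in_ideal_iff_min_gens_divides\<close>). Therefore
  \<open>p(I) = \<mu> * (S * H) = S * (\<mu> * H) = S\<close>.

  All the infinite sums are of families in which each monomial occurs in only finitely many terms.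
  Such a family is summable and may be regrouped along any map (\<open>has_sum_fibres\<close>); grouping the terms
  of \<open>S\<close> by cardinality and splitting off the cardinalities 0 and 1 gives the second formula.
\<close>

section \<open>Coefficientwise summation in the ring of formal sums\<close>

text \<open>
  Continuity of addition and negation makes the general results on moving finitely many terms, or a
  sign, out of an infinite sum applicable to formal sums.
\<close>

instance mseries :: topological_ab_group_add
proof
  fix f g :: mseries
  show "((\<lambda>x. fst x + snd x) \<longlongrightarrow> f + g) (nhds f \<times>\<^sub>F nhds g)"
    unfolding tendsto_mseries_iff
  proof
    fix m
    have "eventually (\<lambda>h. mcoeff h m = mcoeff f m) (nhds f)" for f
      using filterlim_ident[of "nhds f"] unfolding tendsto_mseries_iff by blast
    from eventually_prodI[OF this this]
    show "\<forall>\<^sub>F x in nhds f \<times>\<^sub>F nhds g. mcoeff (fst x + snd x) m = mcoeff (f + g) m"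
      by eventually_elim (simp add: plus_mseries.rep_eq)
  qed
  show "(uminus \<longlongrightarrow> - f) (nhds f)"
    unfolding tendsto_mseries_iff
  proof
    fix m
    have "eventually (\<lambda>h. mcoeff h m = mcoeff f m) (nhds f)"
      using filterlim_ident[of "nhds f"] unfolding tendsto_mseries_iff by blast
    then show "\<forall>\<^sub>F h in nhds f. mcoeff (- h) m = mcoeff (- f) m"
      by eventually_elim (simp add: uminus_mseries.rep_eq)
  qed
qed

text \<open>
  Convergence means that every coefficient is eventually constant, and the coefficient at \<open>m\<close> of a
  partial sum no longer changes once its index set contains \<open>B\<close>.
\<close>

lemma has_sum_mseriesI:
  assumes "\<And>m. \<exists>B. finite B \<and> B \<subseteq> A \<and> (\<forall>a\<in>A - B. mcoeff (f a) m = 0) \<and>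
    mcoeff s m = (\<Sum>a\<in>B. mcoeff (f a) m)"
  shows "(f has_sum s) A"
  unfolding has_sum_def tendsto_mseries_iff
proof
  fix m
  obtain B where B: "finite B" "B \<subseteq> A" "\<forall>a\<in>A - B. mcoeff (f a) m = 0"
      "mcoeff s m = (\<Sum>a\<in>B. mcoeff (f a) m)"
    using assms by metis
  have "eventually (\<lambda>F. finite F \<and> B \<subseteq> F \<and> F \<subseteq> A) (finite_subsets_at_top A)"
    unfolding eventually_finite_subsets_at_top using B by blast
  then show "eventually (\<lambda>F. mcoeff (sum f F) m = mcoeff s m) (finite_subsets_at_top A)"
  proof eventually_elim
    case (elim F)
    have "(\<Sum>a\<in>F. mcoeff (f a) m) = (\<Sum>a\<in>B. mcoeff (f a) m)"
      by (rule sum.mono_neutral_right) (use elim B in auto)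
    with B show ?case by (simp add: mcoeff_sum)
  qed
qed

definition locally_finite_family :: "('a \<Rightarrow> mseries) \<Rightarrow> 'a set \<Rightarrow> bool" where
  "locally_finite_family f A \<longleftrightarrow> (\<forall>m. finite {a \<in> A. mcoeff (f a) m \<noteq> 0})"

lemma locally_finite_family_subset:
  "locally_finite_family f A \<Longrightarrow> B \<subseteq> A \<Longrightarrow> locally_finite_family f B"
  unfolding locally_finite_family_def by (blast intro: rev_finite_subset)

lemma locally_finite_family_has_sum:
  assumes "locally_finite_family f A"
  shows "(f has_sum Abs_mseries (\<lambda>m. \<Sum>a | a \<in> A \<and> mcoeff (f a) m \<noteq> 0. mcoeff (f a) m)) A"
proof (rule has_sum_mseriesI)
  fix m
  show "\<exists>B. finite B \<and> B \<subseteq> A \<and> (\<forall>a\<in>A - B. mcoeff (f a) m = 0) \<and>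
      mcoeff (Abs_mseries (\<lambda>m. \<Sum>a | a \<in> A \<and> mcoeff (f a) m \<noteq> 0. mcoeff (f a) m)) m
        = (\<Sum>a\<in>B. mcoeff (f a) m)"
    using assms by (intro exI[of _ "{a \<in> A. mcoeff (f a) m \<noteq> 0}"])
      (auto simp: locally_finite_family_def Abs_mseries_inverse)
qed

lemma locally_finite_family_summable: "locally_finite_family f A \<Longrightarrow> f summable_on A"
  using locally_finite_family_has_sum summable_on_def by blast

lemma mcoeff_infsum:
  assumes "locally_finite_family f A"
  shows "mcoeff (infsum f A) m = (\<Sum>a | a \<in> A \<and> mcoeff (f a) m \<noteq> 0. mcoeff (f a) m)"
  using infsumI[OF locally_finite_family_has_sum[OF assms]] by (simp add: Abs_mseries_inverse)

text \<open>
  At each monomial only the finitely many indices in the set \<open>S\<close> below contribute, so regrouping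
  reduces to that of a finite sum of integers.
\<close>

lemma has_sum_fibres:
  assumes f: "locally_finite_family f A"
  shows "((\<lambda>k. infsum f {a \<in> A. g a = k}) has_sum infsum f A) UNIV"
proof (rule has_sum_mseriesI)
  fix m
  define S where "S = {a \<in> A. mcoeff (f a) m \<noteq> 0}"
  have fin: "finite S"
    using f by (simp add: S_def locally_finite_family_def)
  have fibre: "mcoeff (infsum f {a \<in> A. g a = k}) m = (\<Sum>a | a \<in> S \<and> g a = k. mcoeff (f a) m)" for k
    unfolding mcoeff_infsum[OF locally_finite_family_subset[OF f Collect_restrict]] S_def
    by (rule sum.cong) auto
  have "mcoeff (infsum f A) m = (\<Sum>k\<in>g ` S. mcoeff (infsum f {a \<in> A. g a = k}) m)"
    unfolding fibre sum.group[OF fin finite_imageI[OF fin] order_refl]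
    by (simp add: mcoeff_infsum[OF f] S_def)
  moreover have "mcoeff (infsum f {a \<in> A. g a = k}) m = 0" if "k \<notin> g ` S" for k
    unfolding fibre using that by (intro sum.neutral) auto
  ultimately show "\<exists>B. finite B \<and> B \<subseteq> UNIV \<and>
      (\<forall>k\<in>UNIV - B. mcoeff (infsum f {a \<in> A. g a = k}) m = 0) \<and>
      mcoeff (infsum f A) m = (\<Sum>k\<in>B. mcoeff (infsum f {a \<in> A. g a = k}) m)"
    using fin by (intro exI[of _ "g ` S"]) auto
qed

lemma infsum_minus_one_power:
  fixes f :: "'a \<Rightarrow> mseries"
  shows "(\<Sum>\<^sub>\<infinity>a\<in>A. (-1) ^ k * f a) = (-1) ^ k * infsum f A"
  by (cases "even k") (simp_all add: infsum_uminus)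

lemma mcoeff_infsum_of_mon: "mcoeff (infsum of_mon A) m = (if m \<in> A then 1 else 0)"
  by (simp add: infsumI[OF has_sum_of_mon] Abs_mseries_inverse)

lemma mcoeff_of_mon_mult:
  "mcoeff (of_mon a * f) m = (if a \<subseteq># m then mcoeff f (m - a) else 0)"
proof -
  have "(\<Sum>(c, d) | c + d = m. mcoeff (of_mon a) c * mcoeff f d)
      = (\<Sum>(c, d)\<in>(if a \<subseteq># m then {(a, m - a)} else {}). mcoeff (of_mon a) c * mcoeff f d)"
    by (rule sum.mono_neutral_right)
      (use finite_factorizations in \<open>auto simp: of_mon.rep_eq split: if_splits\<close>)
  then show ?thesis by (simp add: times_mseries.rep_eq of_mon.rep_eq)
qed

section \<open>The inverse of the sum of all monomials\<close>

lemma mcoeff_mult_all_monomials: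
  "mcoeff (f * infsum of_mon UNIV) m = (\<Sum>a | a \<subseteq># m. mcoeff f a)"
proof -
  have "(\<Sum>(a, b) | a + b = m. mcoeff f a) = (\<Sum>a | a \<subseteq># m. mcoeff f a)"
    by (rule sum.reindex_bij_witness[of _ "\<lambda>a. (a, m - a)" fst]) auto
  then show ?thesis
    by (simp add: times_mseries.rep_eq mcoeff_infsum_of_mon)
qed

text \<open>
  For \<open>i \<notin> A\<close>, the multiples of \<open>x\<^sub>i\<close> without variables from \<open>A\<close> are exactly the products of \<open>x\<^sub>i\<close>
  with a monomial without variables from \<open>A\<close>. So a further factor \<open>1 - x\<^sub>i\<close> removes just these multiples.
\<close>

lemma finite_mu_mult_all_monomials:
  assumes "finite A"
  shows "(\<Prod>i\<in>A. 1 - of_mon {#i#}) * infsum of_mon UNIV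
    = infsum of_mon {m. set_mset m \<inter> A = {}}"
  using assms
proof (induction A rule: finite_induct)
  case (insert i A)
  have "(1 - of_mon {#i#}) * infsum of_mon {m. set_mset m \<inter> A = {}}
      = infsum of_mon {m. set_mset m \<inter> insert i A = {}}"
  proof (rule mseries_eqI)
    fix m
    have "j \<in># m - {#i#} \<longleftrightarrow> j \<in># m" if "j \<in> A" for j
      using that insert.hyps by (auto simp flip: count_greater_zero_iff)
    then have "set_mset (m - {#i#}) \<inter> A = {} \<longleftrightarrow> set_mset m \<inter> A = {}"
      by blast
    then show "mcoeff ((1 - of_mon {#i#}) * infsum of_mon {m. set_mset m \<inter> A = {}}) m
        = mcoeff (infsum of_mon {m. set_mset m \<inter> insert i A = {}}) m"
      by (auto simp: left_diff_distrib minus_mseries.rep_eq mcoeff_of_mon_mult mcoeff_infsum_of_mon)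
  qed
  with insert show ?case by (simp add: mult.assoc)
qed simp

lemma mu_partial_products: "(\<lambda>n. \<Prod>i\<le>n. 1 - of_mon {#i#}) \<longlonglongrightarrow> mu"
proof -
  have "mcoeff (1 - of_mon {#i#}) {#} = 1" for i
    by (simp add: minus_mseries.rep_eq one_mseries.rep_eq of_mon.rep_eq)
  then have "1 - of_mon {#i#} \<noteq> 0" for i
    by (metis zero_mseries.rep_eq zero_neq_one)
  with has_prod_mu show ?thesis
    by (auto simp: has_prod_def raw_has_prod_def)
qed

text \<open>
  The coefficient of a product with the sum of all monomials at \<open>m\<close> involves only the finitely many
  divisors of \<open>m\<close>. Hence a sufficiently long partial product can replace \<open>\<mu>\<close>, and one long enough to
  contain all variables of \<open>m\<close> leaves a nonzero coefficient only for \<open>m = 1\<close>.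
\<close>

lemma mu_mult_all_monomials: "mu * infsum of_mon UNIV = 1"
proof (rule mseries_eqI)
  fix m :: monomial
  have "eventually (\<lambda>n. \<forall>a\<in>{a. a \<subseteq># m}. mcoeff (\<Prod>i\<le>n. 1 - of_mon {#i#}) a = mcoeff mu a)
      sequentially"
    by (rule eventually_ball_finite)
      (use mu_partial_products finite_divisors in \<open>auto simp: tendsto_mseries_iff\<close>)
  then obtain n where n: "\<forall>n'\<ge>n. \<forall>a\<in>{a. a \<subseteq># m}. mcoeff (\<Prod>i\<le>n'. 1 - of_mon {#i#}) a = mcoeff mu a"
    by (auto simp: eventually_sequentially)
  define N where "N = Max (insert n (set_mset m))"
  have "N \<ge> n" and vars: "set_mset m \<subseteq> {..N}"
    by (auto simp: N_def)
  with n have "mcoeff (mu * infsum of_mon UNIV) m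
      = mcoeff ((\<Prod>i\<le>N. 1 - of_mon {#i#}) * infsum of_mon UNIV) m"
    by (simp add: mcoeff_mult_all_monomials)
  also have "\<dots> = mcoeff 1 m"
    using vars by (auto simp: finite_mu_mult_all_monomials mcoeff_infsum_of_mon one_mseries.rep_eq Int_absorb2)
  finally show "mcoeff (mu * infsum of_mon UNIV) m = mcoeff 1 m" .
qed

section \<open>Minimal generators and the signed sum of least common multiples\<close>

text \<open>
  A member of \<open>I\<close> that is not a minimal generator is a proper multiple of another member, and proper
  divisibility is well-founded.
\<close>

lemma min_gens_divides:
  assumes "m \<in> I"
  shows "\<exists>w\<in>min_gens I. w \<subseteq># m"
  using assms
proof (induction m rule: wf_induct_rule[OF wf_subset_mset_rel])
  case (1 m)
  show ?case
  proof (cases "m \<in> min_gens I")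
    case False
    with 1 obtain a b where "m = a + b" "a \<noteq> {#}" "b \<in> I"
      by (auto simp: min_gens_def elim!: set_plus_elim)
    moreover from this have "b \<subset># m" by (simp add: subset_mset_def)
    ultimately obtain w where "w \<in> min_gens I" "w \<subseteq># b"
      using 1(1)[of b] by auto
    with \<open>m = a + b\<close> show ?thesis
      by (metis mset_subset_eq_add_right subset_mset.order_trans)
  qed auto
qed

lemma in_ideal_iff_min_gens_divides:
  assumes "monoid_ideal I"
  shows "m \<in> I \<longleftrightarrow> (\<exists>w\<in>min_gens I. w \<subseteq># m)"
proof
  assume "\<exists>w\<in>min_gens I. w \<subseteq># m"
  then obtain w where "w \<in> I" "w \<subseteq># m" by (auto simp: min_gens_def)
  then have "(m - w) + w \<in> UNIV + I" by (intro set_plus_intro) auto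
  with \<open>w \<subseteq># m\<close> assms show "m \<in> I" by (auto simp: monoid_ideal_def)
qed (rule min_gens_divides)

lemma lcm_mon_dvd_iff: "finite \<sigma> \<Longrightarrow> lcm_mon \<sigma> \<subseteq># m \<longleftrightarrow> (\<forall>w\<in>\<sigma>. w \<subseteq># m)"
  by (meson dvd_lcm_mon lcm_mon_least subset_mset.trans)

lemma lcm_mon_singleton: "lcm_mon {w} = w"
  by (simp add: lcm_mon_def)

lemma mcoeff_signed_of_mon: "mcoeff ((-1) ^ k * of_mon a) m = (if m = a then (-1) ^ k else 0)"
  by (cases "even k") (simp_all add: of_mon.rep_eq uminus_mseries.rep_eq)

text \<open>
  If \<open>lcm \<sigma> = m\<close>, then \<open>\<sigma>\<close> consists of divisors of \<open>m\<close>, of which there are finitely many.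
\<close>

lemma lcm_terms_locally_finite:
  "locally_finite_family (\<lambda>\<sigma>. (-1) ^ card \<sigma> * of_mon (lcm_mon \<sigma>)) {\<sigma>. \<sigma> \<subseteq> W \<and> finite \<sigma>}"
  unfolding locally_finite_family_def
proof
  fix m
  have "{\<sigma> \<in> {\<sigma>. \<sigma> \<subseteq> W \<and> finite \<sigma>}. mcoeff ((-1) ^ card \<sigma> * of_mon (lcm_mon \<sigma>)) m \<noteq> 0}
      \<subseteq> Pow {a. a \<subseteq># m}"
    by (auto simp: mcoeff_signed_of_mon dvd_lcm_mon)
  then show "finite {\<sigma> \<in> {\<sigma>. \<sigma> \<subseteq> W \<and> finite \<sigma>}. mcoeff ((-1) ^ card \<sigma> * of_mon (lcm_mon \<sigma>)) m \<noteq> 0}"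
    by (rule finite_subset) (simp add: finite_divisors)
qed

lemma sum_Pow_minus_one_power_card:
  "finite A \<Longrightarrow> (\<Sum>X\<in>Pow A. (-1 :: int) ^ card X) = (if A = {} then 1 else 0)"
  using prod_diff_conv_sum[of A "\<lambda>_. 1" "\<lambda>_. 1 :: int"] by (simp add: power_0_left)

text \<open>
  The double sum over divisors \<open>a\<close> of \<open>m\<close> and sets \<open>\<sigma>\<close> with \<open>lcm \<sigma> = a\<close> collapses to a sum over all
  sets of elements of \<open>W\<close> that divide \<open>m\<close>, where the signs cancel unless there are no such elements.
\<close>

lemma signed_lcm_sum_mult_all_monomials:
  "(\<Sum>\<^sub>\<infinity>\<sigma>\<in>{\<sigma>. \<sigma> \<subseteq> W \<and> finite \<sigma>}. (-1) ^ card \<sigma> * of_mon (lcm_mon \<sigma>)) * infsum of_mon UNIV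
    = infsum of_mon {m. \<forall>w\<in>W. \<not> w \<subseteq># m}"
proof (rule mseries_eqI)
  fix m
  define D where "D = {w \<in> W. w \<subseteq># m}"
  have fin: "finite D"
    unfolding D_def by (rule finite_subset[OF _ finite_divisors[of m]]) auto
  have lcm_D: "{\<sigma> \<in> Pow D. lcm_mon \<sigma> = a} = {\<sigma>. \<sigma> \<subseteq> W \<and> finite \<sigma> \<and> lcm_mon \<sigma> = a}" if "a \<subseteq># m" for a
    using that fin lcm_mon_dvd_iff[of _ m] by (auto simp: D_def intro: finite_subset)
  let ?S = "\<Sum>\<^sub>\<infinity>\<sigma>\<in>{\<sigma>. \<sigma> \<subseteq> W \<and> finite \<sigma>}. (-1) ^ card \<sigma> * of_mon (lcm_mon \<sigma>)"
  have "mcoeff ?S a = (\<Sum>\<sigma> | \<sigma> \<in> Pow D \<and> lcm_mon \<sigma> = a. (-1) ^ card \<sigma>)" if "a \<subseteq># m" for a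
    unfolding mcoeff_infsum[OF lcm_terms_locally_finite] lcm_D[OF that]
    by (rule sum.cong) (auto simp: mcoeff_signed_of_mon)
  then have "mcoeff (?S * infsum of_mon UNIV) m
      = (\<Sum>a | a \<subseteq># m. \<Sum>\<sigma> | \<sigma> \<in> Pow D \<and> lcm_mon \<sigma> = a. (-1) ^ card \<sigma>)"
    by (simp add: mcoeff_mult_all_monomials)
  also have "\<dots> = (\<Sum>\<sigma>\<in>Pow D. (-1) ^ card \<sigma>)"
  proof (rule sum.group)
    show "lcm_mon ` Pow D \<subseteq> {a. a \<subseteq># m}"
      using finite_subset[OF _ fin] by (auto simp: lcm_mon_dvd_iff D_def)
  qed (use fin finite_divisors in auto)
  also have "\<dots> = mcoeff (infsum of_mon {m. \<forall>w\<in>W. \<not> w \<subseteq># m}) m"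
    unfolding sum_Pow_minus_one_power_card[OF fin] mcoeff_infsum_of_mon by (auto simp: D_def)
  finally show "mcoeff (?S * infsum of_mon UNIV) m
      = mcoeff (infsum of_mon {m. \<forall>w\<in>W. \<not> w \<subseteq># m}) m" .
qed

lemma p_series_eq_signed_lcm_sum:
  assumes "monoid_ideal I"
  shows "p_series I =
    (\<Sum>\<^sub>\<infinity>\<sigma>\<in>{\<sigma>. \<sigma> \<subseteq> min_gens I \<and> finite \<sigma>}. (-1) ^ card \<sigma> * of_mon (lcm_mon \<sigma>))" (is "_ = ?S")
proof -
  have "UNIV - I = {m. \<forall>w\<in>min_gens I. \<not> w \<subseteq># m}"
    using in_ideal_iff_min_gens_divides[OF assms] by auto
  then have "p_series I = mu * (?S * infsum of_mon UNIV)"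
    by (simp add: p_series_def signed_lcm_sum_mult_all_monomials)
  also have "\<dots> = ?S * (mu * infsum of_mon UNIV)"
    by (simp add: ac_simps)
  finally show ?thesis
    by (simp add: mu_mult_all_monomials)
qed

section \<open>Grouping by the number of generators\<close>

theorem theorem4p5:
  fixes I :: "monomial set"
  assumes "monoid_ideal I"
  shows "(\<lambda>\<sigma>. (-1) ^ card \<sigma> * of_mon (lcm_mon \<sigma>)) summable_on {\<sigma>. \<sigma> \<subseteq> min_gens I \<and> finite \<sigma>}
    \<and> p_series I =
        (\<Sum>\<^sub>\<infinity>\<sigma>\<in>{\<sigma>. \<sigma> \<subseteq> min_gens I \<and> finite \<sigma>}. (-1) ^ card \<sigma> * of_mon (lcm_mon \<sigma>))
    \<and> of_mon summable_on min_gens I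
    \<and> (\<forall>k\<ge>2. (\<lambda>\<sigma>. of_mon (lcm_mon \<sigma>)) summable_on [min_gens I]\<^bsup>k\<^esup>)
    \<and> (\<lambda>k. (-1) ^ k * (\<Sum>\<^sub>\<infinity>\<sigma>\<in>[min_gens I]\<^bsup>k\<^esup>. of_mon (lcm_mon \<sigma>))) summable_on {2..}
    \<and> p_series I = 1 - (\<Sum>\<^sub>\<infinity>m\<in>min_gens I. of_mon m)
        + (\<Sum>\<^sub>\<infinity>k\<in>{2..}. (-1) ^ k * (\<Sum>\<^sub>\<infinity>\<sigma>\<in>[min_gens I]\<^bsup>k\<^esup>. of_mon (lcm_mon \<sigma>)))"
proof (intro conjI allI impI)
  define W where "W = min_gens I"
  let ?f = "\<lambda>\<sigma>. (-1) ^ card \<sigma> * of_mon (lcm_mon \<sigma>)"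
  let ?T = "\<lambda>k. infsum (\<lambda>\<sigma>. of_mon (lcm_mon \<sigma>)) ([W]\<^bsup>k\<^esup>)"
  have f: "locally_finite_family ?f {\<sigma>. \<sigma> \<subseteq> W \<and> finite \<sigma>}"
    by (rule lcm_terms_locally_finite)
  have fibre: "{\<sigma> \<in> {\<sigma>. \<sigma> \<subseteq> W \<and> finite \<sigma>}. card \<sigma> = k} = [W]\<^bsup>k\<^esup>" for k
    by (auto simp: nsets_def)
  have signed_T: "infsum ?f ([W]\<^bsup>k\<^esup>) = (-1) ^ k * ?T k" for k
    by (subst infsum_minus_one_power[symmetric], rule infsum_cong) (auto simp: nsets_def)
  have graded: "((\<lambda>k. (-1) ^ k * ?T k) has_sum infsum ?f {\<sigma>. \<sigma> \<subseteq> W \<and> finite \<sigma>}) UNIV"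
    using has_sum_fibres[OF f, of card] by (simp only: fibre signed_T)
  have T0: "?T 0 = 1"
    by (simp add: lcm_mon_empty of_mon_one)
  have "[W]\<^bsup>1\<^esup> = (\<lambda>w. {w}) ` W"
    by (auto simp: nsets_def card_1_singleton_iff)
  then have T1: "?T 1 = infsum of_mon W"
    by (simp add: infsum_reindex o_def lcm_mon_singleton)

  show "?f summable_on {\<sigma>. \<sigma> \<subseteq> min_gens I \<and> finite \<sigma>}"
    using locally_finite_family_summable[OF f] by (simp add: W_def)
  show p: "p_series I = infsum ?f {\<sigma>. \<sigma> \<subseteq> min_gens I \<and> finite \<sigma>}"
    by (rule p_series_eq_signed_lcm_sum[OF assms])
  show "of_mon summable_on min_gens I"
    using has_sum_of_mon summable_on_def by blast
  show "(\<lambda>\<sigma>. of_mon (lcm_mon \<sigma>)) summable_on [min_gens I]\<^bsup>k\<^esup>" for k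
  proof -
    have "?f summable_on [W]\<^bsup>k\<^esup>"
      by (intro locally_finite_family_summable locally_finite_family_subset[OF f])
        (auto simp: nsets_def)
    then have "(\<lambda>\<sigma>. (-1) ^ k * of_mon (lcm_mon \<sigma>)) summable_on [W]\<^bsup>k\<^esup>"
      by (rule summable_on_cong[THEN iffD1, rotated]) (auto simp: nsets_def)
    then show ?thesis
      by (cases "even k") (simp_all add: W_def summable_on_uminus)
  qed

  have "((\<lambda>k. (-1) ^ k * ?T k) has_sum (-1) ^ 0 * ?T 0 + (-1) ^ 1 * ?T 1) {0, 1}"
    by (rule has_sum_finiteI) simp_all
  from has_sum_Diff[OF graded this]
  have "((\<lambda>k. (-1) ^ k * ?T k) has_sum infsum ?f {\<sigma>. \<sigma> \<subseteq> W \<and> finite \<sigma>} - (1 - infsum of_mon W))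
      (UNIV - {0, 1})"
    unfolding T0 T1 by simp
  also have "UNIV - {0, 1} = {2 :: nat..}"
    by auto
  finally have tail: "((\<lambda>k. (-1) ^ k * ?T k) has_sum p_series I - (1 - infsum of_mon W)) {2..}"
    by (simp add: p W_def)
  then show "(\<lambda>k. (-1) ^ k * (\<Sum>\<^sub>\<infinity>\<sigma>\<in>[min_gens I]\<^bsup>k\<^esup>. of_mon (lcm_mon \<sigma>))) summable_on {2..}"
    unfolding W_def summable_on_def by blast
  from infsumI[OF tail]
  show "p_series I = 1 - (\<Sum>\<^sub>\<infinity>m\<in>min_gens I. of_mon m)
      + (\<Sum>\<^sub>\<infinity>k\<in>{2..}. (-1) ^ k * (\<Sum>\<^sub>\<infinity>\<sigma>\<in>[min_gens I]\<^bsup>k\<^esup>. of_mon (lcm_mon \<sigma>)))"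
    by (simp add: W_def)
qed

end
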